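(* For every positive integer $n$, the set $\mathcal{P}^i_{\rm ncn}(n)$ of indecomposable partitions of $[n]$ that are both noncrossing and nonnesting and the set $\mathcal{P}_{\rm tn}(n)$ of totally nested partitions of $[n]$ have the same cardinality.
   Context: A partition of $[n]=\{1,\dots,n\}$ has arc diagram with an arc $(i,j)$, $i<j$, whenever $i,j$ are consecutive elements of the same block. Arcs $(i_1,j_1),(i_2,j_2)$ cross if $i_1<i_2<j_1<j_2$ and nest if $i_1<i_2<j_2<j_1$; noncrossing/nonnesting means no such pair. A partition of $[n]$ is indecomposable if no subset of its blocks is a partition of $[k]$ for some $k<n$. A block $B=\{i_1<\dots<i_r\}$ is nested by a block $B'=\{j_1<\dots<j_s\}$ if there is an index $\ell$ with $j_\ell<i_1<\dots<i_r<j_{\ell+1}$. A partition $\pi$ of $[n]$ is totally nested if its blocks can be listed as $B_1,\dots,B_k$ so that either $k=1$ or for every $1<i\le k$ the block $B_i$ is nested by $B_{i-1}$. *)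

theory Defs
  imports "HOL-Library.Disjoint_Sets"
begin

definition consecutive_in :: "nat set \<Rightarrow> nat \<Rightarrow> nat \<Rightarrow> bool" where
  "consecutive_in B i j \<longleftrightarrow> i \<in> B \<and> j \<in> B \<and> i < j \<and> (\<forall>m\<in>B. \<not> (i < m \<and> m < j))"

definition arcs :: "nat set set \<Rightarrow> (nat \<times> nat) set" where
  "arcs P = {(i, j). \<exists>B\<in>P. consecutive_in B i j}"

definition noncrossing :: "nat set set \<Rightarrow> bool" where
  "noncrossing P \<longleftrightarrow>
     \<not> (\<exists>i1 j1 i2 j2. (i1, j1) \<in> arcs P \<and> (i2, j2) \<in> arcs P \<and> i1 < i2 \<and> i2 < j1 \<and> j1 < j2)"

definition nonnesting :: "nat set set \<Rightarrow> bool" where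
  "nonnesting P \<longleftrightarrow>
     \<not> (\<exists>i1 j1 i2 j2. (i1, j1) \<in> arcs P \<and> (i2, j2) \<in> arcs P \<and> i1 < i2 \<and> i2 < j2 \<and> j2 < j1)"

text \<open>The index \<open>k\<close> starts at 1: for \<open>k = 0\<close> the empty set of blocks is a partition of the
  empty set, so no partition would be indecomposable.\<close>

definition indecomposable :: "nat \<Rightarrow> nat set set \<Rightarrow> bool" where
  "indecomposable n P \<longleftrightarrow> \<not> (\<exists>k Q. 1 \<le> k \<and> k < n \<and> Q \<subseteq> P \<and> partition_on {1..k} Q)"

definition nested_by :: "nat set \<Rightarrow> nat set \<Rightarrow> bool" where
  "nested_by B B' \<longleftrightarrow> (\<exists>a b. consecutive_in B' a b \<and> (\<forall>x\<in>B. a < x \<and> x < b))"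

definition totally_nested :: "nat set set \<Rightarrow> bool" where
  "totally_nested P \<longleftrightarrow>
     (\<exists>Bs. distinct Bs \<and> set Bs = P \<and>
       (length Bs = 1 \<or> (\<forall>i. 0 < i \<and> i < length Bs \<longrightarrow> nested_by (Bs ! i) (Bs ! (i - 1)))))"

definition ncn_indecomposable_partitions :: "nat \<Rightarrow> nat set set set" where
  "ncn_indecomposable_partitions n =
     {P. partition_on {1..n} P \<and> indecomposable n P \<and> noncrossing P \<and> nonnesting P}"

definition totally_nested_partitions :: "nat \<Rightarrow> nat set set set" where
  "totally_nested_partitions n = {P. partition_on {1..n} P \<and> totally_nested P}"

lemma finite_ncn_indecomposable_partitions: "finite (ncn_indecomposable_partitions n)"
  by (rule finite_subset[OF _ finitely_many_partition_on[of "{1..n}"]])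
     (auto simp: ncn_indecomposable_partitions_def)

lemma finite_totally_nested_partitions: "finite (totally_nested_partitions n)"
  by (rule finite_subset[OF _ finitely_many_partition_on[of "{1..n}"]])
     (auto simp: totally_nested_partitions_def)

end

theory Submission
  imports Defs
begin

text \<open>Two arcs of a noncrossing nonnesting partition meet at most in an endpoint. If the partition is
  indecomposable, the arcs therefore form a single path from 1 to \<open>n\<close>: the partition has one block
  containing 1 and \<open>n\<close>, all its other blocks are singletons, so there are \<open>2 ^ (n - 2)\<close> such
  partitions, also for \<open>n = 1\<close> because the subtraction is truncated.
  In a totally nested partition of an interval, the outermost block is either the whole interval or
  what is left after the removal of a nonempty inner interval \<open>{c..d}\<close> that avoids both ends and is
  again totally nested. Summing over \<open>c\<close> and \<open>d\<close> gives \<open>2 ^ (n - 2)\<close> by induction.\<close>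

section \<open>Arcs and blocks\<close>

lemma consecutive_in_around:
  assumes "u \<in> B" "u \<le> x" "v \<in> B" "x < v"
  obtains p q where "consecutive_in B p q" "p \<le> x" "x < q" "q \<le> v"
proof -
  define p where "p = (GREATEST y. y \<in> B \<and> y \<le> x)"
  define q where "q = (LEAST y. y \<in> B \<and> x < y)"
  have p: "p \<in> B \<and> p \<le> x"
    unfolding p_def by (rule GreatestI_nat[of _ u x]) (use assms in auto)
  have p_max: "y \<le> p" if "y \<in> B" "y \<le> x" for y
    unfolding p_def by (rule Greatest_le_nat[of _ _ x]) (use that in auto)
  have q: "q \<in> B \<and> x < q"
    unfolding q_def by (rule LeastI[of _ v]) (use assms in auto)
  have q_min: "q \<le> y" if "y \<in> B" "x < y" for y
    unfolding q_def by (rule Least_le) (use that in auto)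
  have "consecutive_in B p q"
    unfolding consecutive_in_def using p q p_max q_min by (meson leD leI le_less_trans)
  then show thesis
    using p q q_min assms that by blast
qed

lemma partition_on_block_unique:
  assumes "partition_on A P" "B \<in> P" "C \<in> P" "x \<in> B" "x \<in> C"
  shows "B = C"
  using assms unfolding partition_on_def disjoint_def by blast

section \<open>Indecomposable noncrossing nonnesting partitions\<close>

definition with_singletons :: "nat \<Rightarrow> nat set \<Rightarrow> nat set set" where
  "with_singletons n B = insert B ((\<lambda>x. {x}) ` ({1..n} - B))"

lemma arcs_with_singletons: "(i, j) \<in> arcs (with_singletons n B) \<longleftrightarrow> consecutive_in B i j"
  by (auto simp: arcs_def with_singletons_def consecutive_in_def)

text \<open>A subset of the blocks that covers \<open>{1..k}\<close> contains the block of 1, hence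
  also \<open>n\<close>. Distinct arcs of a single block overlap at most in an endpoint, so they
  neither cross nor nest.\<close>

lemma with_singletons_mem:
  assumes "1 \<in> B" "n \<in> B" "B \<subseteq> {1..n}"
  shows "with_singletons n B \<in> ncn_indecomposable_partitions n"
proof -
  have part: "partition_on {1..n} (with_singletons n B)"
    using assms by (auto simp: partition_on_def with_singletons_def disjoint_def)
  have "indecomposable n (with_singletons n B)"
    unfolding indecomposable_def
  proof (intro notI, elim exE conjE)
    fix k Q
    assume k: "1 \<le> k" "k < n" and Q: "Q \<subseteq> with_singletons n B" "partition_on {1..k} Q"
    have "1 \<in> \<Union>Q"
      using k Q(2) by (auto simp: partition_on_def)
    then obtain C where C: "C \<in> Q" "1 \<in> C"
      by blast
    then have "C = B"
      using Q(1) part assms(1) partition_on_block_unique[OF part, of C B 1]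
      by (auto simp: with_singletons_def)
    then have "n \<in> {1..k}"
      using C Q(2) assms(2) by (auto simp: partition_on_def)
    then show False
      using k by simp
  qed
  moreover have "noncrossing (with_singletons n B)" "nonnesting (with_singletons n B)"
    unfolding noncrossing_def nonnesting_def arcs_with_singletons
    by (auto simp: consecutive_in_def)
  ultimately show ?thesis
    using part by (simp add: ncn_indecomposable_partitions_def)
qed

lemma ncn_indecomposable_is_with_singletons:
  assumes P: "P \<in> ncn_indecomposable_partitions n" and n: "n \<ge> 1"
  obtains B where "1 \<in> B" "n \<in> B" "B \<subseteq> {1..n}" "P = with_singletons n B"
proof -
  have part: "partition_on {1..n} P" and ind: "indecomposable n P"
    and nc: "noncrossing P" and nn: "nonnesting P"
    using P by (auto simp: ncn_indecomposable_partitions_def)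
  have un: "\<Union>P = {1..n}" and nonempty: "{} \<notin> P"
    using part by (auto simp: partition_on_def)
  have "1 \<in> \<Union>P"
    using un n by simp
  then obtain B where B: "B \<in> P" "1 \<in> B"
    by blast
  have Bsub: "B \<subseteq> {1..n}"
    using B un by blast
  then have fin: "finite B"
    using finite_subset by blast
  define m where "m = Max B"
  have mB: "m \<in> B" and m_max: "\<And>x. x \<in> B \<Longrightarrow> x \<le> m"
    using Max_in[OF fin] Max_ge[OF fin] B unfolding m_def by blast+
  \<comment> \<open>The arc \<open>(p, q)\<close> of \<open>B\<close> around \<open>i\<close>
    crosses \<open>(i, j)\<close> if \<open>q < j\<close> and encloses it if \<open>j < q\<close>;
    the endpoints differ because the blocks are disjoint.\<close>
  have other: "False"
    if C: "C \<in> P" "C \<noteq> B" "consecutive_in C i j" "i < m" for C i j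
  proof -
    have ij: "i \<in> C" "j \<in> C" "i < j"
      using C by (auto simp: consecutive_in_def)
    have notB: "i \<notin> B" "j \<notin> B"
      using partition_on_block_unique[OF part] C ij B by blast+
    have "1 \<le> i"
      using ij C un by fastforce
    then obtain p q where pq: "consecutive_in B p q" "p \<le> i" "i < q" "q \<le> m"
      using consecutive_in_around[OF B(2) _ mB C(4)] by blast
    have "p \<in> B" "q \<in> B"
      using pq by (auto simp: consecutive_in_def)
    then have "p < i" "q \<noteq> j"
      using notB pq by (auto simp: le_less)
    moreover have "(p, q) \<in> arcs P" "(i, j) \<in> arcs P"
      using pq C B by (auto simp: arcs_def)
    ultimately show False
      using nc nn \<open>i < q\<close> \<open>i < j\<close> unfolding noncrossing_def nonnesting_def
      by (metis linorder_neqE_nat)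
  qed
  have "m = n"
  proof (rule ccontr)
    assume "m \<noteq> n"
    then have "m < n"
      using mB Bsub by (auto simp: le_less)
    \<comment> \<open>A second block with elements both in and beyond \<open>{1..m}\<close> would
      have an arc passing over \<open>m\<close>, starting before \<open>m\<close> because
      \<open>m\<close> belongs to \<open>B\<close>; this contradicts \<open>other\<close>. So the
      blocks inside \<open>{1..m}\<close> partition it, against indecomposability.\<close>
    have below: "C \<subseteq> {1..m}" if C: "C \<in> P" "x \<in> C" "x \<le> m" for C x
    proof (cases "C = B")
      case True
      then show ?thesis
        using m_max Bsub by auto
    next
      case False
      show ?thesis
      proof (rule ccontr)
        assume "\<not> C \<subseteq> {1..m}"
        moreover have "C \<subseteq> {1..n}"
          using C un by blast
        ultimately obtain y where y: "y \<in> C" "m < y"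
          by fastforce
        obtain i j where ij: "consecutive_in C i j" "i \<le> m" "m < j"
          using consecutive_in_around[OF C(2,3) y] by blast
        have "i \<noteq> m"
          using ij mB B C False partition_on_block_unique[OF part, of C B m]
          by (auto simp: consecutive_in_def)
        then show False
          using other[OF C(1) False ij(1)] ij by simp
      qed
    qed
    define Q where "Q = {C \<in> P. C \<subseteq> {1..m}}"
    have "{1..m} \<subseteq> \<Union>Q"
    proof
      fix x
      assume x: "x \<in> {1..m}"
      then have "x \<in> \<Union>P"
        using un \<open>m < n\<close> by auto
      then show "x \<in> \<Union>Q"
        using below x unfolding Q_def by auto
    qed
    then have "\<Union>Q = {1..m}"
      unfolding Q_def by blast
    then have "partition_on {1..m} Q"
      using part unfolding partition_on_def disjoint_def Q_def by blast
    moreover have "1 \<le> m" "Q \<subseteq> P"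
      using m_max B unfolding Q_def by auto
    ultimately show False
      using ind \<open>m < n\<close> unfolding indecomposable_def by blast
  qed
  \<comment> \<open>With \<open>m = n\<close> every arc starts below \<open>m\<close>, so
    \<open>other\<close> leaves no arc outside \<open>B\<close>.\<close>
  have single: "C = {x}" if C: "C \<in> P" "C \<noteq> B" "x \<in> C" for C x
  proof -
    have no: "\<not> u < v" if uv: "u \<in> C" "v \<in> C" for u v
    proof
      assume "u < v"
      then obtain i j where ij: "consecutive_in C i j" "i \<le> u"
        using consecutive_in_around[OF uv(1) order_refl uv(2)] by blast
      have "v \<le> n"
        using uv C un by auto
      then show False
        using other[OF C(1,2) ij(1)] ij \<open>u < v\<close> \<open>m = n\<close> by simp
    qed
    have "y = x" if "y \<in> C" for y
      using no[OF that C(3)] no[OF C(3) that] by simp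
    then show ?thesis
      using C(3) by blast
  qed
  have "P = with_singletons n B"
  proof (intro equalityI subsetI)
    fix C
    assume C: "C \<in> P"
    show "C \<in> with_singletons n B"
    proof (cases "C = B")
      case False
      obtain x where "x \<in> C"
        using C nonempty by fastforce
      then have "C = {x}" "x \<in> {1..n} - B"
        using single[OF C False] C False un B partition_on_block_unique[OF part, of C B x] by blast+
      then show ?thesis
        by (auto simp: with_singletons_def)
    qed (simp add: with_singletons_def)
  next
    fix C
    assume "C \<in> with_singletons n B"
    then consider "C = B" | x where "C = {x}" "x \<in> {1..n}" "x \<notin> B"
      by (auto simp: with_singletons_def)
    then show "C \<in> P"
    proof cases
      case 2
      then obtain D where "D \<in> P" "x \<in> D"
        using un by blast
      then show ?thesis
        using single[of D x] 2 by blast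
    qed (use B in simp)
  qed
  then show thesis
    using that B Bsub mB \<open>m = n\<close> by blast
qed

text \<open>The added singletons avoid \<open>B\<close>, so \<open>B\<close> is recovered as the
  only block containing \<open>a\<close>.\<close>

lemma inj_on_with_singletons: "inj_on (with_singletons n) {B. a \<in> B}"
proof (rule inj_onI)
  fix B C
  assume BC: "B \<in> {B. a \<in> B}" "C \<in> {B. a \<in> B}" and eq: "with_singletons n B = with_singletons n C"
  then have "B \<in> with_singletons n C"
    unfolding with_singletons_def by blast
  then show "B = C"
    using BC by (auto simp: with_singletons_def)
qed

lemma card_ncn_indecomposable_partitions:
  assumes "n \<ge> 1"
  shows "card (ncn_indecomposable_partitions n) = 2 ^ (n - 2)"
proof -
  let ?\<B> = "{B. 1 \<in> B \<and> n \<in> B \<and> B \<subseteq> {1..n}}"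
  have "ncn_indecomposable_partitions n = with_singletons n ` ?\<B>"
    using with_singletons_mem ncn_indecomposable_is_with_singletons[OF _ assms] by blast
  moreover have "inj_on (with_singletons n) ?\<B>"
    by (rule inj_on_subset[OF inj_on_with_singletons[of n 1]]) auto
  ultimately have "card (ncn_indecomposable_partitions n) = card ?\<B>"
    by (simp add: card_image)
  \<comment> \<open>Only the points strictly between 1 and \<open>n\<close> can be chosen freely.
    For \<open>n = 1\<close> this interval is empty and the exponent truncates to 0.\<close>
  also have "\<dots> = card (Pow {1<..<n})"
  proof (rule bij_betw_same_card[OF bij_betw_byWitness
        [where f = "\<lambda>B. B - {1, n}" and f' = "\<lambda>A. {1, n} \<union> A"]])
    show "\<forall>B\<in>?\<B>. {1, n} \<union> (B - {1, n}) = B"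
      by auto
    show "\<forall>A\<in>Pow {1<..<n}. ({1, n} \<union> A) - {1, n} = A"
      by auto
    show "(\<lambda>B. B - {1, n}) ` ?\<B> \<subseteq> Pow {1<..<n}"
    proof (intro image_subsetI PowI subsetI)
      fix B x
      assume "B \<in> ?\<B>" "x \<in> B - {1, n}"
      then have "1 \<le> x" "x \<le> n" "x \<noteq> 1" "x \<noteq> n"
        by auto
      then show "x \<in> {1<..<n}"
        by simp
    qed
    show "(\<lambda>A. {1, n} \<union> A) ` Pow {1<..<n} \<subseteq> ?\<B>"
      using assms by auto
  qed
  also have "\<dots> = 2 ^ (n - 2)"
    by (simp add: card_Pow numeral_2_eq_2)
  finally show ?thesis .
qed

section \<open>Structure of totally nested partitions\<close>

abbreviation nesting_chain :: "nat set list \<Rightarrow> bool" where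
  "nesting_chain \<equiv> successively (\<lambda>B C. nested_by C B)"

text \<open>With \<open>successively\<close> a chain can be split at its head; it holds trivially
  for a single block, which is the case \<open>length Bs = 1\<close>.\<close>

lemma totally_nested_iff:
  "totally_nested P \<longleftrightarrow> (\<exists>Bs. distinct Bs \<and> set Bs = P \<and> nesting_chain Bs)"
proof -
  have "(length Bs = 1 \<or> (\<forall>i. 0 < i \<and> i < length Bs \<longrightarrow> nested_by (Bs ! i) (Bs ! (i - 1))))
    \<longleftrightarrow> nesting_chain Bs" for Bs
  proof -
    have "(\<forall>i. 0 < i \<and> i < length Bs \<longrightarrow> nested_by (Bs ! i) (Bs ! (i - 1)))
      \<longleftrightarrow> (\<forall>i. Suc i < length Bs \<longrightarrow> nested_by (Bs ! Suc i) (Bs ! i))"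
      by (metis Suc_pred diff_Suc_1 zero_less_Suc)
    then show ?thesis
      by (auto simp: successively_conv_nth)
  qed
  then show ?thesis
    unfolding totally_nested_def by simp
qed

text \<open>A nested block lies between two elements of its predecessor, so it cannot leave an open
  interval containing that predecessor. This puts all inner blocks into one gap of the outermost
  block.\<close>

lemma nesting_chain_subset:
  assumes "nesting_chain (C # Cs)" "C \<subseteq> {p<..<q}" "D \<in> set (C # Cs)"
  shows "D \<subseteq> {p<..<q}"
  using assms
proof (induction Cs arbitrary: C)
  case (Cons C' Cs)
  then have "C' \<subseteq> {p<..<q}"
    by (fastforce simp: nested_by_def consecutive_in_def)
  then show ?case
    using Cons by auto
qed simp

text \<open>Arbitrary endpoints make the family closed under removal of the outermost block.\<close>

definition tn_partitions :: "nat \<Rightarrow> nat \<Rightarrow> nat set set set" where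
  "tn_partitions a b = {P. partition_on {a..b} P \<and> totally_nested P}"

lemma finite_tn_partitions: "finite (tn_partitions a b)"
  by (rule finite_subset[OF _ finitely_many_partition_on[of "{a..b}"]])
    (auto simp: tn_partitions_def)

definition outer :: "nat \<Rightarrow> nat \<Rightarrow> nat \<Rightarrow> nat \<Rightarrow> nat set" where
  "outer a b c d = {a..<c} \<union> {d<..b}"

lemma Diff_outer:
  assumes "a < c" "c \<le> d" "d < b"
  shows "{a..b} - outer a b c d = {c..d}"
  using assms by (auto simp: outer_def)

lemma whole_interval_tn_partition:
  assumes "a \<le> b"
  shows "{{a..b}} \<in> tn_partitions a b"
proof -
  have "totally_nested {{a..b}}"
    unfolding totally_nested_iff by (rule exI[of _ "[{a..b}]"]) simp
  then show ?thesis
    using assms by (auto simp: tn_partitions_def partition_on_def)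
qed

lemma insert_outer_tn_partition:
  assumes P: "P \<in> tn_partitions c d" and cd: "a < c" "c \<le> d" "d < b"
  shows "insert (outer a b c d) P \<in> tn_partitions a b"
proof -
  let ?B = "outer a b c d"
  have part: "partition_on {c..d} P"
    using P by (simp add: tn_partitions_def)
  then have un: "\<Union>P = {c..d}"
    by (simp add: partition_on_def)
  obtain Cs where Cs: "distinct Cs" "set Cs = P" "nesting_chain Cs"
    using P by (auto simp: tn_partitions_def totally_nested_iff)
  have ne: "a \<in> ?B"
    using cd by (simp add: outer_def)
  have disj: "disjnt ?B (\<Union>P)"
    unfolding un by (auto simp: outer_def disjnt_def)
  have "partition_on {a..b} (insert ?B P)"
    using part Diff_outer[OF cd] disj ne cd by (auto simp: partition_on_insert outer_def)
  moreover have "?B \<notin> P"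
    using ne disj by (auto simp: disjnt_def)
  moreover have "nesting_chain (?B # Cs)"
  proof (cases Cs)
    case (Cons C Cs')
    then have "C \<subseteq> {c..d}"
      using Cs un by auto
    \<comment> \<open>These are the last element of the left piece and the first of the right piece;
      \<open>a < c\<close> and \<open>d < b\<close> make both pieces nonempty.\<close>
    moreover have "consecutive_in ?B (c - 1) (Suc d)"
      using cd by (auto simp: consecutive_in_def outer_def)
    ultimately have "nested_by C ?B"
      unfolding nested_by_def using cd by fastforce
    then show ?thesis
      using Cons Cs by simp
  qed simp
  ultimately show ?thesis
    unfolding tn_partitions_def totally_nested_iff using Cs
    by (auto intro!: exI[of _ "?B # Cs"])
qed

text \<open>All later blocks of the chain lie in one gap of its head, and the head misses that gap.
  Since the blocks cover \<open>{a..b}\<close>, the head is exactly the complement of the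
  gap.\<close>

lemma tn_partition_cases:
  assumes P: "P \<in> tn_partitions a b" and ab: "a \<le> b"
  obtains "P = {{a..b}}"
  | c d Q where "a < c" "c \<le> d" "d < b" "Q \<in> tn_partitions c d" "P = insert (outer a b c d) Q"
proof -
  have part: "partition_on {a..b} P"
    using P by (simp add: tn_partitions_def)
  then have un: "\<Union>P = {a..b}" and nonempty: "{} \<notin> P"
    by (simp_all add: partition_on_def)
  obtain Bs where Bs: "distinct Bs" "set Bs = P" "nesting_chain Bs"
    using P by (auto simp: tn_partitions_def totally_nested_iff)
  have "Bs \<noteq> []"
    using Bs un ab by auto
  then obtain B Cs where Bs_eq: "Bs = B # Cs"
    by (cases Bs) auto
  show thesis
  proof (cases Cs)
    case Nil
    then have "P = {{a..b}}"
      using Bs Bs_eq un by auto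
    then show thesis
      by (rule that(1))
  next
    case (Cons C Ds)
    then have "nested_by C B"
      using Bs Bs_eq by simp
    then obtain p q where pq: "consecutive_in B p q" and C: "C \<subseteq> {p<..<q}"
      unfolding nested_by_def by fastforce
    have inner: "D \<subseteq> {p<..<q}" if "D \<in> set Cs" for D
      using nesting_chain_subset[OF _ C] that Bs Bs_eq Cons by auto
    have pqB: "p \<in> B" "q \<in> B" "p < q" and gap: "B \<inter> {p<..<q} = {}"
      using pq by (auto simp: consecutive_in_def)
    have B_sub: "B \<subseteq> {a..b}"
      using un Bs Bs_eq by auto
    have un': "B \<union> \<Union>(set Cs) = {a..b}"
      using un Bs Bs_eq by auto
    obtain x where "x \<in> C"
      using nonempty Bs Bs_eq Cons by fastforce
    then have x: "p < x" "x < q"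
      using C by auto
    \<comment> \<open>The open gap is rewritten as a closed interval \<open>{c..d}\<close>; the
      element \<open>x\<close> of \<open>C\<close> makes it nonempty, and \<open>p\<close>,
      \<open>q\<close> keep it away from both ends.\<close>
    define c where "c = Suc p"
    define d where "d = q - 1"
    have "a \<le> p" "q \<le> b"
      using pqB B_sub by auto
    then have cd: "a < c" "c \<le> d" "d < b" "{p<..<q} = {c..d}"
      using x unfolding c_def d_def by (auto simp: less_Suc_eq_le)
    have "\<Union>(set Cs) \<subseteq> {p<..<q}"
      using inner by blast
    then have "B = {a..b} - {c..d}"
      using un' gap unfolding cd(4) by blast
    then have B_eq: "B = outer a b c d"
      using cd by (auto simp: outer_def)
    have "disjnt B (\<Union>(set Cs))"
      using gap inner unfolding disjnt_def by blast
    then have "partition_on ({a..b} - B) (set Cs)"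
      using part Bs Bs_eq partition_on_insert by auto
    moreover have "{a..b} - B = {c..d}"
      using Diff_outer[OF cd(1-3)] B_eq by simp
    moreover have "totally_nested (set Cs)"
      unfolding totally_nested_iff using Bs Bs_eq Cons by (intro exI[of _ Cs]) simp
    ultimately have "set Cs \<in> tn_partitions c d"
      by (simp add: tn_partitions_def)
    then show thesis
      using that(2)[OF cd(1-3)] Bs Bs_eq B_eq by auto
  qed
qed

section \<open>Counting totally nested partitions\<close>

lemma outer_inject:
  assumes "outer a b c d = outer a b c' d'" "a < c" "c \<le> d" "d < b" "a < c'" "c' \<le> d'" "d' < b"
  shows "c = c' \<and> d = d'"
proof -
  \<comment> \<open>Both gaps are the complement of the same block in \<open>{a..b}\<close>.\<close>
  have "{c..d} = {c'..d'}"
    using assms(1) Diff_outer[OF assms(2-4)] Diff_outer[OF assms(5-7)] by metis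
  then show ?thesis
    using assms by (simp add: Icc_eq_Icc)
qed

text \<open>\<open>Suc\<close> accounts for the single block \<open>{a..b}\<close>; the double sum
  runs over the gap of the outermost block and the totally nested partitions filling it.\<close>

lemma card_tn_partitions_rec:
  assumes "a \<le> b"
  shows "card (tn_partitions a b) =
    Suc (\<Sum>d\<in>{a<..<b}. \<Sum>c\<in>{a<..d}. card (tn_partitions c d))"
proof -
  \<comment> \<open>The right end \<open>d\<close> comes first so that, for fixed \<open>d\<close>,
    the sum over \<open>c\<close> can be evaluated by \<open>sum_pow2_diff\<close>.\<close>
  define S where "S = (SIGMA d:{a<..<b}. SIGMA c:{a<..d}. tn_partitions c d)"
  define f where "f = (\<lambda>(d, c, P). insert (outer a b c d) P)"
  have S_iff: "(d, c, P) \<in> S \<longleftrightarrow> a < c \<and> c \<le> d \<and> d < b \<and> P \<in> tn_partitions c d" for d c P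
    by (auto simp: S_def)
  have eq: "tn_partitions a b = insert {{a..b}} (f ` S)"
  proof (intro equalityI subsetI)
    fix P
    assume P: "P \<in> tn_partitions a b"
    show "P \<in> insert {{a..b}} (f ` S)"
    proof (cases rule: tn_partition_cases[OF P assms])
      case (2 c d Q)
      then have "(d, c, Q) \<in> S" "P = f (d, c, Q)"
        by (simp_all add: S_iff f_def)
      then show ?thesis
        by blast
    qed auto
  next
    fix P
    assume "P \<in> insert {{a..b}} (f ` S)"
    then show "P \<in> tn_partitions a b"
      using whole_interval_tn_partition[OF assms] insert_outer_tn_partition
      by (auto simp: S_iff f_def)
  qed
  \<comment> \<open>The point \<open>a\<close> lies in the outer block and in no inner one, so equal
    images under \<open>f\<close> have equal outer blocks, hence equal gaps and equal inner
    partitions.\<close>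
  have a_notin: "a \<notin> \<Union>P" if "(d, c, P) \<in> S" for d c P
    using that by (auto simp: S_iff tn_partitions_def partition_on_def)
  have a_outer: "a \<in> outer a b c d" if "(d, c, P) \<in> S" for d c P
    using that by (auto simp: S_iff outer_def)
  have inj: "inj_on f S"
  proof (rule inj_onI)
    fix x y
    assume xy: "x \<in> S" "y \<in> S" "f x = f y"
    obtain d c P d' c' P' where x: "x = (d, c, P)" and y: "y = (d', c', P')"
      by (cases x, cases y) auto
    have S: "(d, c, P) \<in> S" "(d', c', P') \<in> S" and "f (d, c, P) = f (d', c', P')"
      using xy unfolding x y by auto
    then have ins: "insert (outer a b c d) P = insert (outer a b c' d') P'"
      by (simp add: f_def)
    have notin: "outer a b c d \<notin> P" "outer a b c d \<notin> P'" "outer a b c' d' \<notin> P'"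
      using a_notin a_outer S by blast+
    then have "outer a b c d = outer a b c' d'"
      using ins by blast
    moreover from this have "P = P'"
      using ins notin by (metis insert_ident)
    ultimately show "x = y"
      using outer_inject S unfolding S_iff x y by blast
  qed
  have "{{a..b}} \<notin> f ` S"
  proof
    assume "{{a..b}} \<in> f ` S"
    then obtain d c P where S: "(d, c, P) \<in> S" and "{{a..b}} = f (d, c, P)"
      by auto
    then have "outer a b c d = {a..b}"
      by (auto simp: f_def)
    moreover have "c \<notin> outer a b c d" "c \<in> {a..b}"
      using S by (auto simp: S_iff outer_def)
    ultimately show False
      by simp
  qed
  moreover have "finite S"
    unfolding S_def by (intro finite_SigmaI finite_tn_partitions) auto
  ultimately have "card (tn_partitions a b) = Suc (card S)"
    unfolding eq by (simp add: card_image inj)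
  also have "card S = (\<Sum>d\<in>{a<..<b}. \<Sum>c\<in>{a<..d}. card (tn_partitions c d))"
    unfolding S_def by (simp add: card_SigmaI finite_tn_partitions)
  finally show ?thesis .
qed

text \<open>With \<open>k = d - c\<close> the terms are 1, 1, 2, 4, and so on: truncation at
  \<open>k = 0\<close> adds the extra 1 that completes the geometric sum to a power of two.\<close>

lemma sum_pow2_diff:
  assumes "a < d"
  shows "(\<Sum>c\<in>{a<..d}. (2::nat) ^ (d - c - 1)) = 2 ^ (d - a - 1)"
proof -
  have "(\<Sum>k<Suc m. (2::nat) ^ (k - 1)) = 2 ^ m" for m
    by (induction m) simp_all
  then have "(\<Sum>k<Suc (d - a - 1). (2::nat) ^ (k - 1)) = 2 ^ (d - a - 1)" .
  moreover have "(\<Sum>c\<in>{a<..d}. (2::nat) ^ (d - c - 1)) = (\<Sum>k<Suc (d - a - 1). 2 ^ (k - 1))"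
    by (rule sum.reindex_bij_witness[of _ "\<lambda>k. d - k" "\<lambda>c. d - c"]) (use assms in auto)
  ultimately show ?thesis
    by simp
qed

lemma card_tn_partitions:
  assumes "a \<le> b"
  shows "card (tn_partitions a b) = 2 ^ (b - a - 1)"
  using assms
proof (induction "b - a" arbitrary: a b rule: less_induct)
  case less
  have "(\<Sum>d\<in>{a<..<b}. \<Sum>c\<in>{a<..d}. card (tn_partitions c d)) =
      (\<Sum>d\<in>{a<..<b}. \<Sum>c\<in>{a<..d}. 2 ^ (d - c - 1))"
    by (intro sum.cong refl less) auto
  also have "\<dots> = (\<Sum>d\<in>{a<..<b}. 2 ^ (d - a - 1))"
    by (intro sum.cong refl sum_pow2_diff) auto
  \<comment> \<open>This geometric sum falls short of \<open>2 ^ (b - a - 1)\<close> by one, which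
    the \<open>Suc\<close> of the recursion supplies.\<close>
  also have "\<dots> = (\<Sum>k\<in>{0..<b - a - 1}. 2 ^ k)"
    by (rule sum.reindex_bij_witness[of _ "\<lambda>k. Suc (a + k)" "\<lambda>d. d - a - 1"]) auto
  also have "\<dots> = 2 ^ (b - a - 1) - 1"
    by (rule sum_power2)
  finally show ?case
    using card_tn_partitions_rec[OF less.prems] by simp
qed

theorem theorem5p3:
  fixes n :: nat
  assumes "n \<ge> 1"
  shows "card (ncn_indecomposable_partitions n) = card (totally_nested_partitions n)"
proof -
  have "totally_nested_partitions n = tn_partitions 1 n"
    by (simp add: totally_nested_partitions_def tn_partitions_def)
  \<comment> \<open>The interval from 1 to \<open>n\<close> gives the exponent
    \<open>n - 1 - 1\<close>, equal to \<open>n - 2\<close> also under truncation.\<close>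
  then show ?thesis
    using card_ncn_indecomposable_partitions[OF assms] card_tn_partitions[OF assms]
    by (simp add: numeral_2_eq_2)
qed

end
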